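(* For every sufficiently large integer $n$, there exists a real matrix with $\lfloor n^{2}/6\rfloor$ rows and $2^{2^{\lfloor n/(2\log_2 n)\rfloor}}$ columns that contains no $n\times n$ row-monotone submatrix.
   Context: An $n\times n$ submatrix of a real matrix $A$ is obtained by choosing row indices $i_1<\dots<i_n$ and column indices $j_1<\dots<j_n$ and taking $B(k,l)=A(i_k,j_l)$. A matrix is row-monotone if either every row is monotone increasing or every row is monotone decreasing. *)

theory Defs
  imports Complex_Main "Jordan_Normal_Form.DL_Submatrix"
begin

text \<open>
  Rows are compared from left to right, and the inequalities are weak: with strict ones a constant
  matrix would contain no row-monotone submatrix at all. All rows have the same direction.
\<close>

definition row_monotone :: "real mat \<Rightarrow> bool" where
  "row_monotone B \<longleftrightarrow>
     (\<forall>i<dim_row B. mono_on {..<dim_col B} (\<lambda>j. B $$ (i, j))) \<or>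
     (\<forall>i<dim_row B. antimono_on {..<dim_col B} (\<lambda>j. B $$ (i, j)))"

text \<open>
  In \<^term>\<open>submatrix A I J\<close> the entry at \<open>(k, l)\<close> is the entry of \<open>A\<close> at the \<open>k\<close>-th smallest
  element of \<open>I\<close> and the \<open>l\<close>-th smallest element of \<open>J\<close>, so index sets of size \<open>n\<close> stand for
  increasing index sequences of length \<open>n\<close>.
\<close>

definition has_row_monotone_submatrix :: "nat \<Rightarrow> real mat \<Rightarrow> bool" where
  "has_row_monotone_submatrix n A \<longleftrightarrow>
     (\<exists>I J. I \<subseteq> {..<dim_row A} \<and> card I = n \<and> J \<subseteq> {..<dim_col A} \<and> card J = n \<and>
            row_monotone (submatrix A I J))"

end

theory Submission
  imports Defs
begin

text \<open>
  Write a column index below \<open>2 ^ D\<close> in binary and let row \<open>i\<close> order the columns lexicographically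
  by their digits, reversing the order at position \<open>p\<close> when the sign attached to \<open>(i, p)\<close> is negative.
  On a set \<open>J\<close> of \<open>n\<close> columns, row \<open>i\<close> is increasing only if its sign is positive at every position
  that is the leading difference of two members of \<open>J\<close>, and there are at least \<open>log\<^sub>2 n\<close> such
  positions, because the digits at these positions separate \<open>J\<close>. So it suffices that the sign
  matrix has no constant block with \<open>n\<close> rows and \<open>\<lceil>log\<^sub>2 n\<rceil>\<close> columns, which a union bound provides.
\<close>

section \<open>Leading differences of binary expansions\<close>

definition leading_diff :: "nat \<Rightarrow> nat \<Rightarrow> nat \<Rightarrow> bool" where
  "leading_diff a b p \<longleftrightarrow> \<not> bit a p \<and> bit b p \<and> (\<forall>q>p. bit a q = bit b q)"

text \<open>Halving drops the last digit. If the halves still differ, their leading difference moves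
  up by one position; otherwise only the last digit differs.\<close>

lemma ex_leading_diff:
  assumes "a < b"
  shows "\<exists>p. leading_diff a b p"
  using assms
proof (induction b arbitrary: a rule: less_induct)
  case (less b)
  show ?case
  proof (cases "a div 2 < b div 2")
    case True
    then obtain p where "leading_diff (a div 2) (b div 2) p"
      using less.IH[of "b div 2" "a div 2"] less.prems by auto
    then have "leading_diff a b (Suc p)"
      unfolding leading_diff_def by (auto simp: bit_Suc Suc_less_eq2)
    then show ?thesis by blast
  next
    case False
    with less.prems have eq: "a div 2 = b div 2" "even a" "odd b"
      by presburger+
    then have "leading_diff a b 0"
      unfolding leading_diff_def
      by (auto simp: bit_0 gr0_conv_Suc bit_Suc)
    then show ?thesis by blast
  qed
qed

lemma leading_diff_less:
  assumes "leading_diff a b p" "b < 2 ^ D"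
  shows "p < D"
proof (rule ccontr)
  assume "\<not> p < D"
  then have "b < 2 ^ p"
    using assms(2) by (meson leI le_less_trans less_le_trans one_le_numeral power_increasing)
  then show False
    using assms(1) by (simp add: leading_diff_def bit_iff_odd)
qed

section \<open>Signed lexicographic orders as real values\<close>

text \<open>Realises the lexicographic order of the digits, reversed at the positions outside
  \<open>P\<close>, by real numbers: the weight \<open>2 ^ q\<close> exceeds the sum of all lower
  weights.\<close>

definition signed_value :: "nat \<Rightarrow> nat set \<Rightarrow> nat \<Rightarrow> real" where
  "signed_value D P c = (\<Sum>q<D. (if q \<in> P then 1 else -1) * of_bool (bit c q) * 2 ^ q)"

text \<open>Digits above \<open>p\<close> cancel in the difference, position \<open>p\<close>
  contributes \<open>2 ^ p\<close> with its sign, and the lower positions contribute at most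
  \<open>2 ^ p - 1\<close> in absolute value. The strictness is what later contradicts weak
  monotonicity.\<close>

lemma signed_value_compare:
  assumes ab: "leading_diff a b p" and "p < D"
  shows "p \<in> P \<Longrightarrow> signed_value D P a < signed_value D P b"
    and "p \<notin> P \<Longrightarrow> signed_value D P b < signed_value D P a"
proof -
  let ?s = "\<lambda>q. (if q \<in> P then 1 else -1 :: real)"
  let ?d = "\<lambda>q. of_bool (bit b q) - of_bool (bit a q) :: real"
  define R where "R = (\<Sum>q<p. ?s q * ?d q * 2 ^ q)"
  have "signed_value D P b - signed_value D P a = (\<Sum>q<D. ?s q * ?d q * 2 ^ q)"
    unfolding signed_value_def sum_subtractf[symmetric]
    by (intro sum.cong refl) (simp add: algebra_simps)
  also have "\<dots> = (\<Sum>q<Suc p. ?s q * ?d q * 2 ^ q)"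
    using assms by (intro sum.mono_neutral_right) (auto simp: leading_diff_def)
  also have "\<dots> = R + ?s p * 2 ^ p"
    using ab by (simp add: R_def leading_diff_def)
  finally have diff: "signed_value D P b - signed_value D P a = R + ?s p * 2 ^ p" .
  have "\<bar>R\<bar> \<le> (\<Sum>q<p. \<bar>?s q * ?d q * 2 ^ q\<bar>)"
    unfolding R_def by (rule sum_abs)
  also have "\<dots> \<le> (\<Sum>q<p. 2 ^ q)"
    by (intro sum_mono) (auto simp: abs_mult)
  also have "\<dots> < 2 ^ p"
    by (simp add: sum_power2 geometric_sum)
  finally have "\<bar>R\<bar> < 2 ^ p" .
  with diff show "p \<in> P \<Longrightarrow> signed_value D P a < signed_value D P b"
    and "p \<notin> P \<Longrightarrow> signed_value D P b < signed_value D P a"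
    by auto
qed

section \<open>Counting the leading positions of a column set\<close>

definition leading_diffs :: "nat set \<Rightarrow> nat set" where
  "leading_diffs J = {p. \<exists>a\<in>J. \<exists>b\<in>J. a < b \<and> leading_diff a b p}"

lemma leading_diffs_subset:
  assumes "J \<subseteq> {..<2 ^ D}"
  shows "leading_diffs J \<subseteq> {..<D}"
  using assms leading_diff_less by (fastforce simp: leading_diffs_def)

text \<open>Restricting the digits to \<open>leading_diffs J\<close> stays injective on
  \<open>J\<close>, since the position separating two members belongs to that set.\<close>

lemma card_le_leading_diffs:
  assumes fin: "finite (leading_diffs J)"
  shows "card J \<le> 2 ^ card (leading_diffs J)"
proof -
  let ?digits = "\<lambda>a. {p \<in> leading_diffs J. bit a p}"
  have less: "?digits a \<noteq> ?digits b" if "a \<in> J" "b \<in> J" "a < b" for a b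
  proof -
    obtain p where "leading_diff a b p"
      using ex_leading_diff \<open>a < b\<close> by blast
    then have "p \<in> ?digits b" "p \<notin> ?digits a"
      using that by (auto simp: leading_diffs_def leading_diff_def)
    then show ?thesis by blast
  qed
  have "inj_on ?digits J"
    by (rule inj_onI) (metis less nat_neq_iff)
  moreover have "?digits ` J \<subseteq> Pow (leading_diffs J)" by auto
  ultimately have "card J \<le> card (Pow (leading_diffs J))"
    using fin by (metis card_inj_on_le finite_Pow_iff)
  then show ?thesis using fin by (simp add: card_Pow)
qed

section \<open>From monotone submatrices to constant sign blocks\<close>

lemma row_monotone_submatrixD:
  assumes mono: "row_monotone (submatrix A I J)"
    and I: "I \<subseteq> {..<dim_row A}" and J: "J \<subseteq> {..<dim_col A}"
  shows "(\<forall>i\<in>I. mono_on J (\<lambda>j. A $$ (i, j))) \<or> (\<forall>i\<in>I. antimono_on J (\<lambda>j. A $$ (i, j)))"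
proof -
  let ?B = "submatrix A I J"
  \<comment> \<open>The rank of an index in its set is the position it receives in the submatrix;
    ranks preserve order, so monotonicity carries back to the original indices.\<close>
  let ?r = "\<lambda>i. card {a \<in> I. a < i}" and ?c = "\<lambda>j. card {a \<in> J. a < j}"
  have fin: "finite I" "finite J"
    using I J finite_subset by blast+
  have dims: "dim_row ?B = card I" "dim_col ?B = card J"
    unfolding dim_submatrix using I J by (auto intro!: arg_cong[where f = card])
  have r: "?r i < dim_row ?B" if "i \<in> I" for i
    unfolding dims using that fin by (intro psubset_card_mono) auto
  have c: "?c j < dim_col ?B" if "j \<in> J" for j
    unfolding dims using that fin by (intro psubset_card_mono) auto
  have c_mono: "?c j \<le> ?c j'" if "j \<le> j'" for j j'
    using that fin by (intro card_mono) auto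
  have entry: "?B $$ (?r i, ?c j) = A $$ (i, j)" if "i \<in> I" "j \<in> J" for i j
    using that I J by (intro submatrix_index_card) auto
  show ?thesis
    using mono unfolding row_monotone_def
  proof (elim disjE)
    assume *: "\<forall>i<dim_row ?B. mono_on {..<dim_col ?B} (\<lambda>j. ?B $$ (i, j))"
    have "A $$ (i, j) \<le> A $$ (i, j')" if "i \<in> I" "j \<in> J" "j' \<in> J" "j \<le> j'" for i j j'
      using monotone_onD[OF *[rule_format, OF r[OF \<open>i \<in> I\<close>]], of "?c j" "?c j'"]
        that by (simp add: c c_mono entry)
    then show ?thesis by (auto intro!: monotone_onI)
  next
    assume *: "\<forall>i<dim_row ?B. antimono_on {..<dim_col ?B} (\<lambda>j. ?B $$ (i, j))"
    have "A $$ (i, j') \<le> A $$ (i, j)" if "i \<in> I" "j \<in> J" "j' \<in> J" "j \<le> j'" for i j j'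
      using monotone_onD[OF *[rule_format, OF r[OF \<open>i \<in> I\<close>]], of "?c j" "?c j'"]
        that by (simp add: c c_mono entry)
    then show ?thesis by (auto intro!: monotone_onI)
  qed
qed

text \<open>\<open>G\<close> encodes the sign matrix: it holds the pairs (row, digit position) with
  positive sign.\<close>

definition has_constant_block :: "nat \<Rightarrow> nat \<Rightarrow> nat \<Rightarrow> nat \<Rightarrow> (nat \<times> nat) set \<Rightarrow> bool" where
  "has_constant_block m D n L G \<longleftrightarrow>
     (\<exists>I S. I \<subseteq> {..<m} \<and> card I = n \<and> S \<subseteq> {..<D} \<and> card S = L \<and>
            (I \<times> S \<subseteq> G \<or> I \<times> S \<inter> G = {}))"

text \<open>A common direction of the rows on \<open>J\<close> forces one common sign on all leading
  positions of \<open>J\<close>. The hypothesis on \<open>L\<close> bounds it by the rounded-up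
  binary logarithm of \<open>n\<close>, so \<open>J\<close> has at least \<open>L\<close> such
  positions.\<close>

lemma no_row_monotone_submatrix:
  assumes G: "\<not> has_constant_block m D n L G" and L: "\<And>t. n \<le> 2 ^ t \<Longrightarrow> L \<le> t"
  shows "\<not> has_row_monotone_submatrix n (mat m (2 ^ D) (\<lambda>(i, c). signed_value D (G `` {i}) c))"
    (is "\<not> has_row_monotone_submatrix n ?A")
proof
  assume "has_row_monotone_submatrix n ?A"
  then obtain I J where I: "I \<subseteq> {..<m}" "card I = n" and J: "J \<subseteq> {..<2 ^ D}" "card J = n"
    and mono: "row_monotone (submatrix ?A I J)"
    unfolding has_row_monotone_submatrix_def by auto
  let ?S = "leading_diffs J"
  have S: "?S \<subseteq> {..<D}"
    using J by (intro leading_diffs_subset)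
  then have "finite ?S"
    using finite_subset by blast
  then have "L \<le> card ?S"
    using card_le_leading_diffs[of J] J by (intro L) simp
  \<comment> \<open>There may be more than \<open>L\<close> leading positions, while a block has
    exactly \<open>L\<close> columns.\<close>
  then obtain T where T: "T \<subseteq> ?S" "card T = L"
    by (meson obtain_subset_with_card_n)
  have entry: "?A $$ (i, j) = signed_value D (G `` {i}) j" if "i \<in> I" "j \<in> J" for i j
  proof -
    have "i < m" "j < 2 ^ D"
      using that I(1) J(1) by blast+
    then show ?thesis by simp
  qed
  have diff: "\<exists>a\<in>J. \<exists>b\<in>J. a \<le> b \<and> leading_diff a b p \<and> p < D" if "p \<in> ?S" for p
  proof -
    have "p < D"
      using that S by auto
    moreover obtain a b where "a \<in> J" "b \<in> J" "a < b" "leading_diff a b p"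
      using \<open>p \<in> ?S\<close> unfolding leading_diffs_def by blast
    ultimately show ?thesis
      using less_imp_le by blast
  qed
  from row_monotone_submatrixD[OF mono] I J
  have "(\<forall>i\<in>I. mono_on J (\<lambda>j. ?A $$ (i, j))) \<or> (\<forall>i\<in>I. antimono_on J (\<lambda>j. ?A $$ (i, j)))"
    by simp
  then have "I \<times> ?S \<subseteq> G \<or> I \<times> ?S \<inter> G = {}"
  proof (elim disjE)
    assume *: "\<forall>i\<in>I. mono_on J (\<lambda>j. ?A $$ (i, j))"
    have "(i, p) \<in> G" if "i \<in> I" "p \<in> ?S" for i p
    proof (rule ccontr)
      assume "(i, p) \<notin> G"
      obtain a b where ab: "a \<in> J" "b \<in> J" "a \<le> b" "leading_diff a b p" "p < D"
        using diff[OF \<open>p \<in> ?S\<close>] by blast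
      have "signed_value D (G `` {i}) a \<le> signed_value D (G `` {i}) b"
        using monotone_onD[OF *[rule_format, OF \<open>i \<in> I\<close>] ab(1-3)]
        unfolding entry[OF \<open>i \<in> I\<close> ab(1)] entry[OF \<open>i \<in> I\<close> ab(2)] .
      \<comment> \<open>A negative sign at \<open>p\<close> strictly reverses the order of
        \<open>a\<close> and \<open>b\<close> in row \<open>i\<close>.\<close>
      then show False
        using signed_value_compare(2)[OF ab(4,5), of "G `` {i}"] \<open>(i, p) \<notin> G\<close> by auto
    qed
    then show ?thesis by auto
  next
    assume *: "\<forall>i\<in>I. antimono_on J (\<lambda>j. ?A $$ (i, j))"
    have "(i, p) \<notin> G" if "i \<in> I" "p \<in> ?S" for i p
    proof
      assume "(i, p) \<in> G"
      obtain a b where ab: "a \<in> J" "b \<in> J" "a \<le> b" "leading_diff a b p" "p < D"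
        using diff[OF \<open>p \<in> ?S\<close>] by blast
      have "signed_value D (G `` {i}) b \<le> signed_value D (G `` {i}) a"
        using monotone_onD[OF *[rule_format, OF \<open>i \<in> I\<close>] ab(1-3)]
        unfolding entry[OF \<open>i \<in> I\<close> ab(1)] entry[OF \<open>i \<in> I\<close> ab(2)] .
      then show False
        using signed_value_compare(1)[OF ab(4,5), of "G `` {i}"] \<open>(i, p) \<in> G\<close> by auto
    qed
    then show ?thesis by auto
  qed
  with T have "I \<times> T \<subseteq> G \<or> I \<times> T \<inter> G = {}" by blast
  then have "has_constant_block m D n L G"
    unfolding has_constant_block_def using I T S by blast
  with G show False by blast
qed

section \<open>Union bound over sign matrices\<close>

text \<open>Once it is fixed whether \<open>G\<close> contains or avoids \<open>W\<close>, only its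
  part in \<open>U - W\<close> is free.\<close>

lemma card_constant_on_le:
  assumes "finite U" "W \<subseteq> U"
  shows "card {G. G \<subseteq> U \<and> (W \<subseteq> G \<or> W \<inter> G = {})} \<le> 2 * 2 ^ (card U - card W)"
proof -
  have "{G. G \<subseteq> U \<and> (W \<subseteq> G \<or> W \<inter> G = {})} \<subseteq> (\<union>) W ` Pow (U - W) \<union> Pow (U - W)"
  proof
    fix G assume "G \<in> {G. G \<subseteq> U \<and> (W \<subseteq> G \<or> W \<inter> G = {})}"
    then have "G \<subseteq> U" and "W \<subseteq> G \<or> W \<inter> G = {}" by auto
    then have "G = W \<union> (G - W) \<or> G \<subseteq> U - W" and "G - W \<in> Pow (U - W)" by auto
    then show "G \<in> (\<union>) W ` Pow (U - W) \<union> Pow (U - W)" by blast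
  qed
  then have "card {G. G \<subseteq> U \<and> (W \<subseteq> G \<or> W \<inter> G = {})} \<le> card ((\<union>) W ` Pow (U - W) \<union> Pow (U - W))"
    using assms by (intro card_mono) auto
  also have "\<dots> \<le> card ((\<union>) W ` Pow (U - W)) + card (Pow (U - W))"
    by (rule card_Un_le)
  also have "\<dots> \<le> card (Pow (U - W)) + card (Pow (U - W))"
    using assms by (intro add_right_mono card_image_le) auto
  also have "\<dots> = 2 * 2 ^ (card U - card W)"
    using assms by (simp add: card_Pow card_Diff_subset finite_subset)
  finally show ?thesis .
qed

text \<open>Union bound by counting: if every sign matrix had a constant block, summing over all
  block positions would have to reach all \<open>2 ^ (m * D)\<close> matrices.\<close>

lemma ex_no_constant_block:
  assumes "2 * (m choose n) * (D choose L) < 2 ^ (n * L)"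
  shows "\<exists>G. \<not> has_constant_block m D n L G"
proof (rule ccontr)
  assume "\<nexists>G. \<not> has_constant_block m D n L G"
  then have all: "has_constant_block m D n L G" for G by blast
  let ?U = "{..<m} \<times> {..<D}"
  let ?X = "{I. I \<subseteq> {..<m} \<and> card I = n} \<times> {S. S \<subseteq> {..<D} \<and> card S = L}"
  let ?F = "\<lambda>(I, S). {G. G \<subseteq> ?U \<and> (I \<times> S \<subseteq> G \<or> I \<times> S \<inter> G = {})}"
  have fin: "finite ?X" by auto
  have card_X: "card ?X = (m choose n) * (D choose L)"
    by (simp add: card_cartesian_product n_subsets)
  have "Pow ?U \<subseteq> (\<Union>x\<in>?X. ?F x)"
    using all unfolding has_constant_block_def by fastforce
  then have "card (Pow ?U) \<le> card (\<Union>x\<in>?X. ?F x)"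
    using fin by (intro card_mono) auto
  also have "\<dots> \<le> (\<Sum>x\<in>?X. card (?F x))"
    using fin by (rule card_UN_le)
  also have "\<dots> \<le> (\<Sum>x\<in>?X. 2 * 2 ^ (m * D - n * L))"
  proof (rule sum_mono)
    fix x assume "x \<in> ?X"
    then obtain I S where x: "x = (I, S)" "I \<subseteq> {..<m}" "card I = n" "S \<subseteq> {..<D}" "card S = L"
      by auto
    then have "card (?F x) \<le> 2 * 2 ^ (card ?U - card (I \<times> S))"
      unfolding x(1) prod.case by (intro card_constant_on_le) auto
    then show "card (?F x) \<le> 2 * 2 ^ (m * D - n * L)"
      using x by (simp add: card_cartesian_product)
  qed
  also have "\<dots> = 2 * (m choose n) * (D choose L) * 2 ^ (m * D - n * L)"
    by (simp only: sum_constant card_X) simp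
  finally have le: "2 ^ (m * D) \<le> 2 * (m choose n) * (D choose L) * 2 ^ (m * D - n * L)"
    by (simp add: card_Pow card_cartesian_product)
  \<comment> \<open>A block of the required size exists, so \<open>n * L\<close> is at most
    \<open>m * D\<close> and the subtraction in the exponent is not truncated.\<close>
  have "?X \<noteq> {}"
    using all[of "{}"] unfolding has_constant_block_def by blast
  then have "n \<le> m" "L \<le> D"
    by (auto dest: card_mono[rotated])
  then have "(2::nat) ^ (m * D) = 2 ^ (n * L) * 2 ^ (m * D - n * L)"
    by (simp add: mult_le_mono flip: power_add)
  with le have "(2::nat) ^ (n * L) \<le> 2 * (m choose n) * (D choose L)"
    by simp
  with assms show False by simp
qed

section \<open>Estimates for factorials and binomials\<close>

text \<open>\<open>n ^ n / fact n\<close> is a single term of the series for \<open>exp n\<close>,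
  and \<open>exp 1\<close> is at most 3.\<close>

lemma fact_ge_power_div_3: "(real n / 3) ^ n \<le> fact n"
proof -
  have "real n ^ n /\<^sub>R fact n \<le> exp (real n)"
    using sum_le_suminf[OF sums_summable[OF exp_converges[of "real n"]], of "{n}"]
    by (simp add: sums_unique[OF exp_converges])
  also have "\<dots> = exp 1 ^ n"
    by (simp flip: exp_of_nat_mult)
  also have "\<dots> \<le> 3 ^ n"
    using exp_le by (intro power_mono) auto
  finally show ?thesis
    by (simp add: field_simps)
qed

lemma choose_le_power: "n choose k \<le> n ^ k"
  using binomial_fact_pow[of n k] by (metis fact_ge_1 le_trans mult.right_neutral mult_le_mono2)

text \<open>The 6 splits as 2 times 3: the 3 absorbs the factorial bound, and the 2 leaves the gain
  \<open>2 ^ n\<close> that the union bound spends.\<close>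

lemma choose_sixth_square_le:
  assumes "real m \<le> real n ^ 2 / 6"
  shows "2 ^ n * (m choose n) \<le> n ^ n"
proof (cases "n = 0")
  case False
  have "real (m choose n) * (real n / 3) ^ n \<le> real (m choose n) * fact n"
    by (intro mult_left_mono fact_ge_power_div_3) auto
  also have "\<dots> \<le> real m ^ n"
    using binomial_fact_pow[of m n] by (metis of_nat_fact of_nat_le_iff of_nat_mult of_nat_power)
  also have "\<dots> \<le> (real n ^ 2 / 6) ^ n"
    using assms by (intro power_mono) auto
  also have "\<dots> = (real n / 2) ^ n * (real n / 3) ^ n"
    by (simp add: power2_eq_square flip: power_mult_distrib)
  finally have "real (m choose n) \<le> (real n / 2) ^ n"
    using False by simp
  then have "real (2 ^ n * (m choose n)) \<le> real (n ^ n)"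
    by (simp add: power_divide field_simps)
  then show ?thesis by (simp only: of_nat_le_iff)
qed simp

section \<open>Choice of parameters\<close>

theorem theorem3:
  shows "\<exists>N::nat. \<forall>n\<ge>N. \<exists>A :: real mat.
           A \<in> carrier_mat (nat \<lfloor>real n ^ 2 / 6\<rfloor>) (2 ^ (2 ^ nat \<lfloor>real n / (2 * log 2 (real n))\<rfloor>)) \<and>
           \<not> has_row_monotone_submatrix n A"
\<comment> \<open>From 5 on, \<open>3 * n / 4 + 1 < n\<close>, which \<open>kL\<close>
  needs.\<close>
proof (intro exI[of _ 5] allI impI)
  fix n :: nat
  assume n: "5 \<le> n"
  define m where "m = nat \<lfloor>real n ^ 2 / 6\<rfloor>"
  define k where "k = nat \<lfloor>real n / (2 * log 2 (real n))\<rfloor>"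
  define L where "L = nat \<lceil>log 2 (real n)\<rceil>"
  have log: "2 \<le> log 2 (real n)"
    using n by (simp add: le_log_iff)
  have L_le: "L \<le> t" if "n \<le> 2 ^ t" for t
  proof -
    have "real n \<le> 2 ^ t"
      using that by (metis of_nat_le_iff of_nat_numeral of_nat_power)
    then have "log 2 (real n) \<le> t"
      using n by (simp add: log_le_iff powr_realpow)
    then show ?thesis by (simp add: L_def nat_le_iff ceiling_le_iff)
  qed
  have "log 2 (real n) \<le> L"
    unfolding L_def by linarith
  then have "real n \<le> 2 ^ L"
    using n by (simp add: log_le_iff powr_realpow)
  then have n_le: "n \<le> 2 ^ L"
    by (metis of_nat_le_iff of_nat_numeral of_nat_power)
  \<comment> \<open>Rounding the logarithm up costs at most 1, hence at most \<open>n / 4\<close>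
    after multiplication by \<open>k\<close>, since the logarithm is at least 2.\<close>
  have "real (k * L) = real k * real L" by simp
  also have "\<dots> \<le> real n / (2 * log 2 (real n)) * (log 2 (real n) + 1)"
    using log by (intro mult_mono) (auto simp: k_def L_def; linarith)+
  also have "\<dots> = real n / 2 + real n / (2 * log 2 (real n))"
    using log by (simp add: field_simps)
  also have "\<dots> \<le> real n / 2 + real n / 4"
    using log by (intro add_left_mono divide_left_mono) auto
  finally have kL: "Suc (k * L) < n"
    using n by linarith
  have "real m \<le> real n ^ 2 / 6"
    unfolding m_def by (rule of_nat_floor) simp
  then have "2 ^ n * (m choose n) \<le> n ^ n"
    by (rule choose_sixth_square_le)
  also have "\<dots> \<le> (2 ^ L) ^ n"
    using n_le by (intro power_mono) auto
  finally have choose_m: "2 ^ n * (m choose n) \<le> 2 ^ (n * L)"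
    by (simp add: mult.commute flip: power_mult)
  have choose_D: "2 ^ k choose L \<le> 2 ^ (k * L)"
    using choose_le_power[of "2 ^ k" L] by (simp add: power_mult)
  have "2 * (m choose n) * (2 ^ k choose L) < 2 ^ (n * L)"
  \<comment> \<open>The binomial vanishes for \<open>n = 5\<close>, where \<open>m = 4\<close>; the
    strict step below needs it positive.\<close>
  proof (cases "m choose n = 0")
    case False
    have "2 * (m choose n) * (2 ^ k choose L) \<le> 2 ^ Suc (k * L) * (m choose n)"
      using choose_D by simp
    \<comment> \<open>The gain \<open>2 ^ n\<close> outweighs both the choice of positions, at most
      \<open>2 ^ (k * L)\<close>, and the factor 2 for the two signs.\<close>
    also have "\<dots> < 2 ^ n * (m choose n)"
      using False kL by (intro mult_strict_right_mono power_strict_increasing) auto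
    finally show ?thesis using choose_m by linarith
  qed (simp del: binomial_eq_0_iff)
  then obtain G where "\<not> has_constant_block m (2 ^ k) n L G"
    using ex_no_constant_block by blast
  then have "\<not> has_row_monotone_submatrix n
      (mat m (2 ^ 2 ^ k) (\<lambda>(i, c). signed_value (2 ^ k) (G `` {i}) c))"
    using L_le by (rule no_row_monotone_submatrix)
  then show "\<exists>A :: real mat. A \<in> carrier_mat (nat \<lfloor>real n ^ 2 / 6\<rfloor>)
      (2 ^ (2 ^ nat \<lfloor>real n / (2 * log 2 (real n))\<rfloor>)) \<and> \<not> has_row_monotone_submatrix n A"
    unfolding m_def k_def by (meson mat_carrier)
qed

end
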